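(* There is a family of capacitated facility location (CFL) instances with $2n$ facilities and $n^4+1$ clients such that the relaxations obtained from (LP-classic) at $\Omega(n)$ levels of the Sherali-Adams hierarchy have an integrality gap of $\Omega(n)$.
   Context: CFL: given facilities $F$ with opening costs $f_i$, clients $C$ with unit demand, metric connection costs $c_{ij}$, and a uniform capacity $U$ (each open facility may serve at most $U$ clients); open facilities and assign each client to an open facility, minimizing opening plus connection cost. (LP-classic) for CFL is: minimize $\sum_{i\in F} f_iy_i+\sum_{i\in F}\sum_{j\in C}c_{ij}x_{ij}$ subject to $x_{ij}\le y_i$ for all $i,j$; $\sum_{i\in F}x_{ij}=1$ for all $j$; $\sum_j x_{ij}\le Uy_i$ for all $i$; $0\le y_i,x_{ij}\le 1$. Sherali-Adams level $k$: for every constraint $\pi(x)\le 0$ of the polytope and every set $U'$ of at most $k$ variables and $W\subseteq U'$, add $\pi(x)\prod_{x_i\in U'-W}x_i\prod_{x_i\in W}(1-x_i)\le 0$, linearize by replacing $x_i^2$ with $x_i$ and $\prod_{x_i\in I}x_i$ with a new variable $x_I$, and project onto the original variables. All variables (facility opening and client assignment) are lifted. *)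

theory Defs
  imports Complex_Main "HOL-Library.Poly_Mapping" "HOL-Library.FuncSet" "HOL-Library.Landau_Symbols"
begin

record ('f, 'c) cfl =
  facilities :: "'f set"
  clients :: "'c set"
  opening_cost :: "'f \<Rightarrow> real"
  connection_cost :: "'f \<Rightarrow> 'c \<Rightarrow> real"
  capacity :: nat

text \<open>As usual in facility location, distinct points may be co-located, so a metric may vanish
  on distinct points.\<close>

definition metric_on :: "'a set \<Rightarrow> ('a \<Rightarrow> 'a \<Rightarrow> real) \<Rightarrow> bool" where
  "metric_on S d \<longleftrightarrow>
     (\<forall>p\<in>S. d p p = 0) \<and>
     (\<forall>p\<in>S. \<forall>q\<in>S. 0 \<le> d p q \<and> d p q = d q p) \<and>
     (\<forall>p\<in>S. \<forall>q\<in>S. \<forall>r\<in>S. d p r \<le> d p q + d q r)"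

definition metric_cfl :: "('f, 'c) cfl \<Rightarrow> bool" where
  "metric_cfl I \<longleftrightarrow>
     finite (facilities I) \<and> finite (clients I) \<and>
     (\<forall>i\<in>facilities I. 0 \<le> opening_cost I i) \<and>
     (\<exists>d. metric_on (facilities I <+> clients I) d \<and>
          (\<forall>i\<in>facilities I. \<forall>j\<in>clients I. connection_cost I i j = d (Inl i) (Inr j)))"

text \<open>A solution is a pair of a set of open facilities and an assignment of the clients.\<close>

definition cfl_solutions :: "('f, 'c) cfl \<Rightarrow> ('f set \<times> ('c \<Rightarrow> 'f)) set" where
  "cfl_solutions I =
     {(S, \<sigma>). S \<subseteq> facilities I \<and> \<sigma> \<in> clients I \<rightarrow> S \<and>
              (\<forall>i\<in>S. card {j \<in> clients I. \<sigma> j = i} \<le> capacity I)}"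

definition cfl_cost :: "('f, 'c) cfl \<Rightarrow> 'f set \<times> ('c \<Rightarrow> 'f) \<Rightarrow> real" where
  "cfl_cost I = (\<lambda>(S, \<sigma>).
     (\<Sum>i\<in>S. opening_cost I i) + (\<Sum>j\<in>clients I. connection_cost I (\<sigma> j) j))"


text \<open>Multivariate polynomials over the variables \<open>'v\<close>: finitely supported maps from monomials,
  which are finitely supported exponent vectors, to coefficients.\<close>

type_synonym 'v mpoly = "('v \<Rightarrow>\<^sub>0 nat) \<Rightarrow>\<^sub>0 real"

definition mvar :: "'v \<Rightarrow> 'v mpoly" where
  "mvar v = Poly_Mapping.single (Poly_Mapping.single v 1) 1"

text \<open>Replacing every power of a variable by the variable itself turns a monomial into the product
  over its support \<open>J\<close>, for which the new variable \<open>z J\<close> is substituted.\<close>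

definition linearize :: "('v set \<Rightarrow> real) \<Rightarrow> 'v mpoly \<Rightarrow> real" where
  "linearize z p = (\<Sum>m\<in>Poly_Mapping.keys p. Poly_Mapping.lookup p m * z (Poly_Mapping.keys m))"

text \<open>A member \<open>\<pi>\<close> of \<open>Q\<close> stands for the constraint \<open>\<pi> \<le> 0\<close>. The empty product is the
  constant \<open>1\<close>, whence \<open>z {} = 1\<close>. Points are only determined on the variables in \<open>V\<close>.\<close>

definition sherali_adams :: "'v set \<Rightarrow> 'v mpoly set \<Rightarrow> nat \<Rightarrow> ('v \<Rightarrow> real) set" where
  "sherali_adams V Q k =
     {x. \<exists>z. z {} = 1 \<and> (\<forall>v\<in>V. x v = z {v}) \<and>
         (\<forall>\<pi>\<in>Q. \<forall>A W. A \<subseteq> V \<and> finite A \<and> card A \<le> k \<and> W \<subseteq> A \<longrightarrow>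
            linearize z (\<pi> * (\<Prod>v\<in>A - W. mvar v) * (\<Prod>v\<in>W. 1 - mvar v)) \<le> 0)}"


datatype ('f, 'c) lp_var = Y 'f | X 'f 'c

definition lp_vars :: "('f, 'c) cfl \<Rightarrow> ('f, 'c) lp_var set" where
  "lp_vars I = Y ` facilities I \<union> {X i j | i j. i \<in> facilities I \<and> j \<in> clients I}"

text \<open>The equality constraints are split into two inequalities.\<close>

definition lp_classic :: "('f, 'c) cfl \<Rightarrow> ('f, 'c) lp_var mpoly set" where
  "lp_classic I =
     {mvar (X i j) - mvar (Y i) | i j. i \<in> facilities I \<and> j \<in> clients I} \<union>
     {(\<Sum>i\<in>facilities I. mvar (X i j)) - 1 | j. j \<in> clients I} \<union>
     {1 - (\<Sum>i\<in>facilities I. mvar (X i j)) | j. j \<in> clients I} \<union>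
     {(\<Sum>j\<in>clients I. mvar (X i j)) - of_nat (capacity I) * mvar (Y i) | i. i \<in> facilities I} \<union>
     {- mvar v | v. v \<in> lp_vars I} \<union>
     {mvar v - 1 | v. v \<in> lp_vars I}"

definition lp_cost :: "('f, 'c) cfl \<Rightarrow> (('f, 'c) lp_var \<Rightarrow> real) \<Rightarrow> real" where
  "lp_cost I x =
     (\<Sum>i\<in>facilities I. opening_cost I i * x (Y i)) +
     (\<Sum>i\<in>facilities I. \<Sum>j\<in>clients I. connection_cost I i j * x (X i j))"

definition sa_relaxation :: "('f, 'c) cfl \<Rightarrow> nat \<Rightarrow> (('f, 'c) lp_var \<Rightarrow> real) set" where
  "sa_relaxation I k = sherali_adams (lp_vars I) (lp_classic I) k"

text \<open>Meaningful for instances with a solution; if the relaxation has optimum \<open>0\<close>, the value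
  is \<open>0\<close>.\<close>

definition integrality_gap :: "('f, 'c) cfl \<Rightarrow> (('f, 'c) lp_var \<Rightarrow> real) set \<Rightarrow> real" where
  "integrality_gap I P =
     (INF s\<in>cfl_solutions I. cfl_cost I s) / (INF x\<in>P. lp_cost I x)"

end

theory Submission
  imports Defs
begin

text \<open>All connection costs are \<open>0\<close> and the capacity is \<open>n ^ 4\<close>. Facility \<open>0\<close> is free, the other
  \<open>2 * n - 1\<close> facilities cost \<open>1\<close>. Facility \<open>0\<close> alone is one unit short of serving all clients,
  so every integral solution costs at least \<open>1\<close>.

  For the relaxation, take a probability distribution on 0/1 points. Point \<open>s > 0\<close>, of probability
  \<open>1 / n ^ 2\<close>, opens \<open>0\<close> and \<open>s\<close> and sends to \<open>s\<close> a block of \<open>n + 1\<close> clients, disjoint from the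
  blocks of the other points. Point \<open>0\<close>, which gets the remaining probability, opens only \<open>0\<close> and
  sends all clients there; it violates a single constraint, by \<open>1\<close>. Every variable distinguishes
  point \<open>0\<close> from at most one other point. Hence an event on fewer than \<open>n\<close> variables that contains
  point \<open>0\<close> contains at least \<open>n\<close> other points, and their slack \<open>n\<close> compensates for the violation.
  The expected opening cost is below \<open>2 / n\<close>.\<close>

section \<open>Linearization\<close>

lemma linearize_add: "linearize z (p + q) = linearize z p + linearize z q"
  unfolding linearize_def
  by (rule setsum_keys_plus_distrib) (simp_all add: distrib_right)

lemma linearize_single: "linearize z (Poly_Mapping.single m c) = c * z (Poly_Mapping.keys m)"
  by (simp add: linearize_def)

lemma linearize_zero: "linearize z 0 = 0"
  by (simp add: linearize_def)

lemma linearize_uminus: "linearize z (- p) = - linearize z p"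
  using linearize_add[of z p "- p"] by (simp add: linearize_zero)

lemma linearize_diff: "linearize z (p - q) = linearize z p - linearize z q"
  using linearize_add[of z p "- q"] by (simp add: linearize_uminus)

lemma linearize_sum: "linearize z (sum f A) = (\<Sum>a\<in>A. linearize z (f a))"
  by (induction A rule: infinite_finite_induct) (simp_all add: linearize_zero linearize_add)

lemma linearize_one: "linearize z 1 = z {}"
  using linearize_single[of z 0 1] by simp

lemma linearize_mvar: "linearize z (mvar v) = z {v}"
  by (simp add: mvar_def linearize_single)

lemma linearize_of_nat_mult: "linearize z (of_nat c * p) = of_nat c * linearize z p"
  by (induction c) (simp_all add: linearize_zero linearize_add distrib_right)

lemmas linearize_simps =
  linearize_add linearize_zero linearize_uminus linearize_diff linearize_sum linearize_one
  linearize_mvar linearize_of_nat_mult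

text \<open>\<open>linearize\<close> is linear in the values \<open>z\<close> as well as in the
  polynomial.\<close>

lemma linearize_convex_combination:
  "linearize (\<lambda>J. \<Sum>s\<in>S. w s * z s J) p = (\<Sum>s\<in>S. w s * linearize (z s) p)"
  unfolding linearize_def sum_distrib_left
  by (subst sum.swap) (simp add: ac_simps)

text \<open>For the indicator of the subsets of \<open>T\<close>, linearization is evaluation at the 0/1 point whose
  support is \<open>T\<close>, hence multiplicative.\<close>

definition eval_at :: "'v set \<Rightarrow> 'v mpoly \<Rightarrow> real" where
  "eval_at T = linearize (\<lambda>J. of_bool (J \<subseteq> T))"

lemma eval_at_mvar: "eval_at T (mvar v) = of_bool (v \<in> T)"
  by (simp add: eval_at_def linearize_simps)

lemma eval_at_one: "eval_at T 1 = 1"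
  by (simp add: eval_at_def linearize_simps)

text \<open>Natural exponents cannot cancel, so no variable disappears from a product of
  monomials.\<close>

lemma keys_add_nat:
  fixes m m' :: "'v \<Rightarrow>\<^sub>0 nat"
  shows "Poly_Mapping.keys (m + m') = Poly_Mapping.keys m \<union> Poly_Mapping.keys m'"
  by (auto simp: in_keys_iff lookup_add)

lemma mpoly_eq_sum_single:
  fixes p :: "'v mpoly"
  shows "p = (\<Sum>m\<in>Poly_Mapping.keys p. Poly_Mapping.single m (Poly_Mapping.lookup p m))"
  by (rule poly_mapping_eqI) (auto simp: lookup_sum lookup_single when_def in_keys_iff)

text \<open>The support of a product of monomials is the union of their supports, and a union lies
  in \<open>T\<close> iff both parts do.\<close>

lemma eval_at_mult: "eval_at T (p * q) = eval_at T p * eval_at T q"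
proof -
  let ?l = Poly_Mapping.lookup and ?k = Poly_Mapping.keys
  have "p * q = (\<Sum>m\<in>?k p. \<Sum>m'\<in>?k q. Poly_Mapping.single (m + m') (?l p m * ?l q m'))"
    by (subst mpoly_eq_sum_single[of p], subst mpoly_eq_sum_single[of q])
       (simp add: sum_product mult_single)
  then have "eval_at T (p * q) =
      (\<Sum>m\<in>?k p. \<Sum>m'\<in>?k q. ?l p m * ?l q m' * of_bool (?k m \<subseteq> T \<and> ?k m' \<subseteq> T))"
    by (simp add: eval_at_def linearize_sum linearize_single keys_add_nat)
  also have "\<dots> = eval_at T p * eval_at T q"
    by (simp only: eval_at_def linearize_def sum_product of_bool_conj ac_simps)
  finally show ?thesis .
qed

lemma eval_at_prod: "eval_at T (prod f A) = (\<Prod>a\<in>A. eval_at T (f a))"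
  by (induction A rule: infinite_finite_induct) (simp_all add: eval_at_one eval_at_mult)

text \<open>At a 0/1 point every factor of the multiplier is 0 or 1, so the multiplier is the
  indicator of an event: among the variables of \<open>A\<close>, exactly those of
  \<open>A - W\<close> are 1.\<close>

lemma eval_at_event:
  assumes "finite A" "W \<subseteq> A"
  shows "eval_at T (\<pi> * (\<Prod>v\<in>A - W. mvar v) * (\<Prod>v\<in>W. 1 - mvar v)) =
    of_bool (T \<inter> A = A - W) * eval_at T \<pi>"
proof -
  have "(\<Prod>v\<in>A - W. eval_at T (mvar v)) = of_bool (A - W \<subseteq> T)"
    using assms by (auto simp: eval_at_mvar prod_eq_1_iff subset_eq intro!: prod_zero)
  moreover have "eval_at T (1 - mvar v) = of_bool (v \<notin> T)" for v
    using eval_at_mvar[of T v] eval_at_one[of T] by (simp add: eval_at_def linearize_diff)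
  then have "(\<Prod>v\<in>W. eval_at T (1 - mvar v)) = of_bool (W \<inter> T = {})"
    using finite_subset[OF assms(2,1)] by (auto intro!: prod_zero prod.neutral)
  moreover have "A - W \<subseteq> T \<and> W \<inter> T = {} \<longleftrightarrow> T \<inter> A = A - W"
    using assms by blast
  ultimately show ?thesis
    by (simp add: eval_at_mult eval_at_prod flip: of_bool_conj mult.assoc)
qed

section \<open>Sherali-Adams solutions from distributions\<close>

text \<open>The value \<open>z J\<close> is the probability that all variables in \<open>J\<close>
  are 1, so a lifted constraint bounds the expectation of \<open>\<pi>\<close> restricted to an
  event. Single points may violate \<open>\<pi>\<close>.\<close>

lemma sherali_adams_mixture:
  assumes sum: "sum w S = 1"
    and event: "\<And>\<pi> A B. \<pi> \<in> Q \<Longrightarrow> A \<subseteq> V \<Longrightarrow> finite A \<Longrightarrow> card A \<le> k \<Longrightarrow>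
      (\<Sum>s\<in>S. w s * (of_bool (T s \<inter> A = B) * eval_at (T s) \<pi>)) \<le> 0"
  shows "(\<lambda>v. \<Sum>s\<in>S. w s * of_bool (v \<in> T s)) \<in> sherali_adams V Q k"
proof -
  define z where "z = (\<lambda>J. \<Sum>s\<in>S. w s * of_bool (J \<subseteq> T s))"
  have "linearize z p = (\<Sum>s\<in>S. w s * eval_at (T s) p)" for p
    by (simp add: z_def linearize_convex_combination eval_at_def)
  then have "linearize z (\<pi> * (\<Prod>v\<in>A - W. mvar v) * (\<Prod>v\<in>W. 1 - mvar v)) \<le> 0"
    if "\<pi> \<in> Q" "A \<subseteq> V" "finite A" "card A \<le> k" "W \<subseteq> A" for \<pi> A W
    using event[of \<pi> A "A - W"] that by (simp add: eval_at_event)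
  moreover have "z {} = 1" "\<And>v. (\<Sum>s\<in>S. w s * of_bool (v \<in> T s)) = z {v}"
    using sum by (simp_all add: z_def)
  ultimately show ?thesis
    unfolding sherali_adams_def by blast
qed

lemma sherali_adams_imp_linearize_le:
  assumes "x \<in> sherali_adams V Q k"
  obtains z where "z {} = 1" "\<And>v. v \<in> V \<Longrightarrow> z {v} = x v" "\<And>\<pi>. \<pi> \<in> Q \<Longrightarrow> linearize z \<pi> \<le> 0"
proof -
  obtain z where z: "z {} = 1" "\<forall>v\<in>V. x v = z {v}"
    "\<forall>\<pi>\<in>Q. \<forall>A W. A \<subseteq> V \<and> finite A \<and> card A \<le> k \<and> W \<subseteq> A \<longrightarrow>
       linearize z (\<pi> * (\<Prod>v\<in>A - W. mvar v) * (\<Prod>v\<in>W. 1 - mvar v)) \<le> 0"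
    using assms unfolding sherali_adams_def mem_Collect_eq by (elim exE conjE)
  have "linearize z \<pi> \<le> 0" if "\<pi> \<in> Q" for \<pi>
    \<comment> \<open>With \<open>A\<close> empty the multiplier is 1, so every level implies the
      original constraints.\<close>
    using z(3)[rule_format, OF that, of "{}" "{}"] by simp
  with z(1,2) show ?thesis
    by (intro that[of z]) simp_all
qed

lemma
  assumes x: "x \<in> sa_relaxation I k"
  shows sa_relaxation_demand: "j \<in> clients I \<Longrightarrow> 1 \<le> (\<Sum>i\<in>facilities I. x (X i j))"
    and sa_relaxation_load: "i \<in> facilities I \<Longrightarrow>
      (\<Sum>j\<in>clients I. x (X i j)) \<le> real (capacity I) * x (Y i)"
    and sa_relaxation_le_one: "v \<in> lp_vars I \<Longrightarrow> x v \<le> 1"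
proof -
  obtain z where z: "z {} = 1" "\<And>v. v \<in> lp_vars I \<Longrightarrow> z {v} = x v"
    "\<And>\<pi>. \<pi> \<in> lp_classic I \<Longrightarrow> linearize z \<pi> \<le> 0"
    using x unfolding sa_relaxation_def by (rule sherali_adams_imp_linearize_le) blast
  have zX: "z {X i j} = x (X i j)" if "i \<in> facilities I" "j \<in> clients I" for i j
    using that by (intro z(2)) (auto simp: lp_vars_def)
  have zY: "z {Y i} = x (Y i)" if "i \<in> facilities I" for i
    using that by (intro z(2)) (auto simp: lp_vars_def)
  show "1 \<le> (\<Sum>i\<in>facilities I. x (X i j))" if j: "j \<in> clients I"
  proof -
    have "1 - (\<Sum>i\<in>facilities I. mvar (X i j)) \<in> lp_classic I"
      using j unfolding lp_classic_def by blast
    from z(3)[OF this] zX j z(1) show ?thesis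
      by (simp add: linearize_simps)
  qed
  show "(\<Sum>j\<in>clients I. x (X i j)) \<le> real (capacity I) * x (Y i)" if i: "i \<in> facilities I"
  proof -
    have "(\<Sum>j\<in>clients I. mvar (X i j)) - of_nat (capacity I) * mvar (Y i) \<in> lp_classic I"
      using i unfolding lp_classic_def by blast
    from z(3)[OF this] zX zY i show ?thesis
      by (simp add: linearize_simps)
  qed
  show "x v \<le> 1" if v: "v \<in> lp_vars I"
  proof -
    have "mvar v - 1 \<in> lp_classic I"
      using v unfolding lp_classic_def by blast
    from z(3)[OF this] z(1,2) v show ?thesis
      by (simp add: linearize_simps)
  qed
qed

section \<open>Mixtures of 0/1 points given by assignments\<close>

definition assignment_support ::
    "('f, 'c) cfl \<Rightarrow> 'f set \<Rightarrow> ('c \<Rightarrow> 'f) \<Rightarrow> ('f, 'c) lp_var set" where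
  "assignment_support I S \<sigma> = Y ` S \<union> (\<lambda>j. X (\<sigma> j) j) ` clients I"

lemma assignment_support_simps:
  "Y i \<in> assignment_support I S \<sigma> \<longleftrightarrow> i \<in> S"
  "X i j \<in> assignment_support I S \<sigma> \<longleftrightarrow> j \<in> clients I \<and> i = \<sigma> j"
  by (auto simp: assignment_support_def)

lemma eval_at_load:
  assumes "finite (clients I)"
  shows "eval_at (assignment_support I S \<sigma>)
      ((\<Sum>j\<in>clients I. mvar (X i j)) - of_nat c * mvar (Y i)) =
    real (card {j \<in> clients I. \<sigma> j = i}) - real c * of_bool (i \<in> S)"
proof -
  have "{j \<in> clients I. \<sigma> j = i} = clients I \<inter> {j. i = \<sigma> j}"
    by auto
  with assms show ?thesis
    by (simp add: eval_at_def linearize_simps assignment_support_simps)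
qed

lemma eval_at_demand:
  assumes "finite (facilities I)" "\<sigma> j \<in> facilities I" "j \<in> clients I"
  shows "eval_at (assignment_support I S \<sigma>) (\<Sum>i\<in>facilities I. mvar (X i j)) = 1"
  using assms by (simp add: eval_at_def linearize_simps assignment_support_simps of_bool_def)

text \<open>The points satisfy all constraints except possibly the capacities, so only these have to
  be checked on average over events.\<close>

lemma assignment_mixture_in_sa_relaxation:
  assumes fin: "finite (facilities I)" "finite (clients I)"
    and w: "\<And>s. s \<in> R \<Longrightarrow> 0 \<le> w s" "sum w R = 1"
    and S: "\<And>s. s \<in> R \<Longrightarrow> S s \<subseteq> facilities I"
    and \<sigma>: "\<And>s. s \<in> R \<Longrightarrow> \<sigma> s \<in> clients I \<rightarrow> S s"
    and load: "\<And>i A B. i \<in> facilities I \<Longrightarrow> finite A \<Longrightarrow> card A \<le> k \<Longrightarrow>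
      (\<Sum>s\<in>R. w s * (of_bool (assignment_support I (S s) (\<sigma> s) \<inter> A = B) *
        (real (card {j \<in> clients I. \<sigma> s j = i}) - real (capacity I) * of_bool (i \<in> S s)))) \<le> 0"
  shows "(\<lambda>v. \<Sum>s\<in>R. w s * of_bool (v \<in> assignment_support I (S s) (\<sigma> s))) \<in> sa_relaxation I k"
  unfolding sa_relaxation_def
proof (rule sherali_adams_mixture)
  fix \<pi> and A B :: "('a, 'b) lp_var set"
  assume \<pi>: "\<pi> \<in> lp_classic I" and A: "finite A" "card A \<le> k"
  let ?T = "\<lambda>s. assignment_support I (S s) (\<sigma> s)"
  show "(\<Sum>s\<in>R. w s * (of_bool (?T s \<inter> A = B) * eval_at (?T s) \<pi>)) \<le> 0"
  proof (cases "\<exists>i\<in>facilities I.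
      \<pi> = (\<Sum>j\<in>clients I. mvar (X i j)) - of_nat (capacity I) * mvar (Y i)")
    case True
    with load A fin show ?thesis
      by (auto simp: eval_at_load)
  next
    case False
    have "eval_at (?T s) \<pi> \<le> 0" if s: "s \<in> R" for s
    proof -
      have demand: "eval_at (?T s) (\<Sum>i\<in>facilities I. mvar (X i j)) = 1" if "j \<in> clients I" for j
        using eval_at_demand[OF fin(1)] S[OF s] \<sigma>[OF s] that by blast
      from \<pi> False consider
        (opened) i j where "\<pi> = mvar (X i j) - mvar (Y i)"
        | (demand_le) j where "j \<in> clients I" "\<pi> = (\<Sum>i\<in>facilities I. mvar (X i j)) - 1"
        | (demand_ge) j where "j \<in> clients I" "\<pi> = 1 - (\<Sum>i\<in>facilities I. mvar (X i j))"
        | (nonneg) v where "\<pi> = - mvar v"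
        | (le_one) v where "\<pi> = mvar v - 1"
        unfolding lp_classic_def by blast
      then show ?thesis
      proof cases
        case opened
        then show ?thesis
          using \<sigma>[OF s] by (auto simp: eval_at_def linearize_simps assignment_support_simps)
      qed (use demand in \<open>auto simp: eval_at_def linearize_simps\<close>)
    qed
    with w(1) show ?thesis
      by (intro sum_nonpos mult_nonneg_nonpos) simp_all
  qed
qed fact

section \<open>The instances\<close>

definition gap_instance :: "nat \<Rightarrow> (nat, nat) cfl" where
  "gap_instance n = \<lparr>facilities = {..<2 * n}, clients = {..n ^ 4},
     opening_cost = (\<lambda>i. if i = 0 then 0 else 1), connection_cost = (\<lambda>_ _. 0), capacity = n ^ 4\<rparr>"

lemma gap_instance_simps [simp]:
  "facilities (gap_instance n) = {..<2 * n}"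
  "clients (gap_instance n) = {..n ^ 4}"
  "opening_cost (gap_instance n) i = (if i = 0 then 0 else 1)"
  "connection_cost (gap_instance n) i j = 0"
  "capacity (gap_instance n) = n ^ 4"
  by (simp_all add: gap_instance_def)

lemma metric_cfl_gap_instance: "metric_cfl (gap_instance n)"
  by (auto simp: metric_cfl_def metric_on_def intro!: exI[of _ "\<lambda>_ _. 0"])

lemma cfl_solutions_gap_instance:
  assumes "n \<ge> 1"
  shows "cfl_solutions (gap_instance n) \<noteq> {}"
proof -
  \<comment> \<open>One client goes to facility 1; the other \<open>n ^ 4\<close> fill facility 0
    exactly.\<close>
  define \<sigma> :: "nat \<Rightarrow> nat" where "\<sigma> = (\<lambda>j. if j = 0 then 1 else 0)"
  have "{j \<in> {..n ^ 4}. \<sigma> j = 0} = {1..n ^ 4}" "{j \<in> {..n ^ 4}. \<sigma> j = 1} = {0}"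
    by (auto simp: \<sigma>_def)
  then have "({0, 1}, \<sigma>) \<in> cfl_solutions (gap_instance n)"
    using assms by (auto simp: cfl_solutions_def) (auto simp: \<sigma>_def)
  then show ?thesis
    by blast
qed

lemma one_le_cfl_cost_gap_instance:
  assumes "s \<in> cfl_solutions (gap_instance n)"
  shows "1 \<le> cfl_cost (gap_instance n) s"
proof -
  obtain S \<sigma> where s: "s = (S, \<sigma>)"
    by fastforce
  have S: "S \<subseteq> {..<2 * n}" "\<sigma> \<in> {..n ^ 4} \<rightarrow> S"
    and cap: "\<And>i. i \<in> S \<Longrightarrow> card {j \<in> {..n ^ 4}. \<sigma> j = i} \<le> n ^ 4"
    using assms by (auto simp: s cfl_solutions_def)
  have "\<not> S \<subseteq> {0}"
  proof
    assume "S \<subseteq> {0}"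
    have "\<sigma> j \<in> S" if "j \<le> n ^ 4" for j
      using S(2) that by auto
    with \<open>S \<subseteq> {0}\<close> have "\<sigma> j = 0 \<and> 0 \<in> S" if "j \<le> n ^ 4" for j
      using that by force
    then have "0 \<in> S" "{j \<in> {..n ^ 4}. \<sigma> j = 0} = {..n ^ 4}"
      by auto
    with cap[of 0] show False
      by simp
  qed
  then obtain i where i: "i \<in> S" "i \<noteq> 0"
    by blast
  have "finite S"
    using S(1) finite_subset by blast
  then have "(if i = 0 then 0 else 1) \<le> (\<Sum>i\<in>S. if i = 0 then 0 else 1 :: real)"
    using i(1) by (intro member_le_sum) auto
  with i(2) show ?thesis
    by (simp add: s cfl_cost_def)
qed

lemma lp_cost_gap_instance:
  "lp_cost (gap_instance n) x = (\<Sum>i\<in>{1..<2 * n}. x (Y i))"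
proof -
  have "lp_cost (gap_instance n) x = (\<Sum>i\<in>{..<2 * n}. (if i = 0 then 0 else x (Y i)))"
    by (auto simp: lp_cost_def intro!: sum.cong)
  also have "\<dots> = (\<Sum>i\<in>{1..<2 * n}. x (Y i))"
    by (rule sum.mono_neutral_cong_right) auto
  finally show ?thesis .
qed

text \<open>Total demand \<open>n ^ 4 + 1\<close> exceeds what facility 0 can carry, as its opening
  variable is at most 1. A positive bound keeps the denominator of the gap away from 0, where the
  quotient would be 0 by convention.\<close>

lemma lp_cost_gap_instance_ge:
  assumes "n \<ge> 1" and x: "x \<in> sa_relaxation (gap_instance n) k"
  shows "1 / real n ^ 4 \<le> lp_cost (gap_instance n) x"
proof -
  let ?I = "gap_instance n" and ?F = "{..<2 * n}" and ?C = "{..n ^ 4}"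
  have demand: "1 \<le> (\<Sum>i\<in>?F. x (X i j))" if "j \<in> ?C" for j
    using sa_relaxation_demand[OF x] that by simp
  have load: "(\<Sum>j\<in>?C. x (X i j)) \<le> real n ^ 4 * x (Y i)" if "i \<in> ?F" for i
    using sa_relaxation_load[OF x] that by simp
  have y0: "x (Y 0) \<le> 1"
    using assms(1) by (intro sa_relaxation_le_one[OF x]) (auto simp: lp_vars_def)
  have "real n ^ 4 + 1 = (\<Sum>j\<in>?C. 1)"
    by simp
  also have "\<dots> \<le> (\<Sum>j\<in>?C. \<Sum>i\<in>?F. x (X i j))"
    using demand by (intro sum_mono) auto
  also have "\<dots> = (\<Sum>i\<in>?F. \<Sum>j\<in>?C. x (X i j))"
    by (rule sum.swap)
  also have "\<dots> \<le> (\<Sum>i\<in>?F. real n ^ 4 * x (Y i))"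
    using load by (intro sum_mono) auto
  also have "\<dots> = real n ^ 4 * (x (Y 0) + lp_cost ?I x)"
    using assms(1) unfolding lp_cost_gap_instance
    by (simp add: lessThan_atLeast0 sum.atLeast_Suc_lessThan flip: sum_distrib_left)
  also have "\<dots> \<le> real n ^ 4 * (1 + lp_cost ?I x)"
    using y0 by (intro mult_left_mono) auto
  finally show ?thesis
    using assms(1) by (simp add: field_simps)
qed

section \<open>The fractional solution\<close>

text \<open>Block \<open>s\<close> is a run of \<open>n + 1\<close> consecutive clients. For
  \<open>s = 0\<close> both branches agree, so point 0 needs no separate definition.\<close>

definition block_assignment :: "nat \<Rightarrow> nat \<Rightarrow> nat \<Rightarrow> nat" where
  "block_assignment n s j = (if j div (n + 1) = s then s else 0)"

definition gap_support :: "nat \<Rightarrow> nat \<Rightarrow> (nat, nat) lp_var set" where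
  "gap_support n s = assignment_support (gap_instance n) {0, s} (block_assignment n s)"

text \<open>With weight \<open>1 / n ^ 2\<close>, \<open>n\<close> points of slack \<open>n\<close>
  offset a violation by 1, while all \<open>2 * n - 1\<close> points together cost less than
  \<open>2 / n\<close>.\<close>

definition gap_weight :: "nat \<Rightarrow> nat \<Rightarrow> real" where
  "gap_weight n s = (if s = 0 then 1 - real (2 * n - 1) / real n ^ 2 else 1 / real n ^ 2)"

lemma sum_gap_weight:
  assumes "n \<ge> 1"
  shows "sum (gap_weight n) {..<2 * n} = 1"
proof -
  have "sum (gap_weight n) {..<2 * n} = gap_weight n 0 + sum (gap_weight n) {1..<2 * n}"
    using assms by (simp add: lessThan_atLeast0 sum.atLeast_Suc_lessThan)
  also have "sum (gap_weight n) {1..<2 * n} = (\<Sum>s\<in>{1..<2 * n}. 1 / real n ^ 2)"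
    by (intro sum.cong) (auto simp: gap_weight_def)
  finally show ?thesis
    using assms by (simp add: gap_weight_def)
qed

lemma gap_weight_nonneg: "0 \<le> gap_weight n s"
proof -
  \<comment> \<open>This is the nonnegativity of the square of \<open>n - 1\<close>.\<close>
  have "2 * real n - 1 \<le> real n ^ 2"
    using zero_le_power2[of "real n - 1"] by (simp add: power2_diff)
  then have "real (2 * n - 1) \<le> real n ^ 2"
    by (cases n) simp_all
  then have "real (2 * n - 1) / real n ^ 2 \<le> 1"
    by (cases "n = 0") (simp_all add: divide_le_eq_1)
  then show ?thesis
    by (simp add: gap_weight_def)
qed

lemma card_block:
  assumes "n \<ge> 2" "s < 2 * n"
  shows "card {j \<in> {..n ^ 4}. j div (n + 1) = s} = n + 1"
proof -
  \<comment> \<open>All \<open>2 * n\<close> blocks must fit among the clients; the bound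
    \<open>2 * n * (n + 1) \<le> n ^ 4\<close> fails for \<open>n = 1\<close>.\<close>
  have "(s + 1) * (n + 1) \<le> 2 * n * (n + 1)"
    using assms by (intro mult_right_mono) auto
  also have "\<dots> \<le> n ^ 4"
  proof -
    have "2 * n * (n + 1) \<le> n * n * (n * n)"
      using assms(1) by (intro mult_mono) (auto intro: order_trans[of _ "2 * n"])
    then show ?thesis
      by (simp add: numeral_eq_Suc)
  qed
  finally have le: "(s + 1) * (n + 1) \<le> n ^ 4" .
  have "j div (n + 1) = s \<longleftrightarrow> s * (n + 1) \<le> j \<and> j < (s + 1) * (n + 1)" for j
    by (metis Suc_eq_plus1 add_gr_0 div_nat_eqI dividend_less_div_times div_times_less_eq_dividend
        less_numeral_extra(1) mult.commute mult_Suc add.commute)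
  with le have "{j \<in> {..n ^ 4}. j div (n + 1) = s} = {s * (n + 1)..<(s + 1) * (n + 1)}"
    by force
  then show ?thesis
    by simp
qed

lemma card_load_block:
  assumes "n \<ge> 2" "0 < s" "s < 2 * n"
  shows "card {j \<in> {..n ^ 4}. block_assignment n s j = i} =
    (if i = 0 then n ^ 4 - n else if i = s then n + 1 else 0)"
proof (cases "i = 0")
  case True
  have "{j \<in> {..n ^ 4}. block_assignment n s j = 0} =
      {..n ^ 4} - {j \<in> {..n ^ 4}. j div (n + 1) = s}"
    using assms(2) by (auto simp: block_assignment_def)
  \<comment> \<open>From \<open>n ^ 4 + 1\<close> clients a block of \<open>n + 1\<close> is
    removed, which leaves slack \<open>n\<close> at facility 0.\<close>
  also have "card \<dots> = n ^ 4 - n"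
    using card_block[OF assms(1,3)] by (subst card_Diff_subset) auto
  finally show ?thesis
    using True by simp
next
  case False
  then have "{j \<in> {..n ^ 4}. block_assignment n s j = i} =
      (if i = s then {j \<in> {..n ^ 4}. j div (n + 1) = s} else {})"
    by (auto simp: block_assignment_def)
  with False card_block[OF assms(1,3)] show ?thesis
    by simp
qed

lemma block_assignment_0: "block_assignment n 0 j = 0"
  by (simp add: block_assignment_def)

text \<open>The only point \<open>s > 0\<close> at which a variable can differ from its value at point \<open>0\<close>.\<close>

fun touched :: "nat \<Rightarrow> (nat, nat) lp_var \<Rightarrow> nat" where
  "touched n (Y i) = i"
| "touched n (X i j) = (if i = 0 then j div (n + 1) else i)"

text \<open>A client leaves facility 0 only at the point of its own block, and a facility
  \<open>i > 0\<close> opens and serves clients only at point \<open>i\<close>.\<close>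

lemma gap_support_untouched:
  assumes "s \<noteq> touched n v"
  shows "v \<in> gap_support n s \<longleftrightarrow> v \<in> gap_support n 0"
proof (cases v)
  case (Y i)
  with assms show ?thesis
    by (auto simp: gap_support_def assignment_support_simps)
next
  case (X i j)
  show ?thesis
  proof (cases "i = 0")
    case True
    with assms X have "block_assignment n s j = 0"
      by (simp add: block_assignment_def)
    with X show ?thesis
      by (simp add: gap_support_def assignment_support_simps block_assignment_0)
  next
    case False
    with assms X have "block_assignment n s j \<noteq> i"
      by (simp add: block_assignment_def)
    with X False show ?thesis
      by (auto simp: gap_support_def assignment_support_simps block_assignment_0)
  qed
qed

lemma card_untouched_ge:
  assumes "finite A" "card A < n"
  shows "n \<le> card {s \<in> {1..<2 * n}. gap_support n s \<inter> A = gap_support n 0 \<inter> A}"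
proof -
  \<comment> \<open>At most \<open>n - 1\<close> of the \<open>2 * n - 1\<close> points are
    touched.\<close>
  have "n \<le> card {1..<2 * n} - card (touched n ` A)"
    using assms card_image_le[OF assms(1), of "touched n"] by simp
  also have "\<dots> \<le> card ({1..<2 * n} - touched n ` A)"
    using assms(1) by (intro diff_card_le_card_Diff) simp
  also have "\<dots> \<le> card {s \<in> {1..<2 * n}. gap_support n s \<inter> A = gap_support n 0 \<inter> A}"
    using gap_support_untouched by (intro card_mono) auto
  finally show ?thesis .
qed

lemma gap_mixture_load:
  assumes n: "n \<ge> 2" and i: "i < 2 * n" and A: "finite A" "card A < n"
  shows "(\<Sum>s<2 * n. gap_weight n s * (of_bool (gap_support n s \<inter> A = B) *
    (real (card {j \<in> {..n ^ 4}. block_assignment n s j = i}) -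
     real (n ^ 4) * of_bool (i \<in> {0, s})))) \<le> 0" (is "(\<Sum>s<2 * n. ?t s) \<le> 0")
proof -
  have "n ^ 1 < n ^ 4"
    using n by (intro power_strict_increasing) auto
  then have n4: "n + 1 \<le> n ^ 4"
    by simp
  have pos: "?t s \<le> 0" if "0 < s" "s < 2 * n" for s
    unfolding card_load_block[OF n that] using that of_nat_mono[OF n4, where 'a = real]
    by (intro mult_nonneg_nonpos gap_weight_nonneg) auto
  show ?thesis
  proof (cases "i = 0 \<and> gap_support n 0 \<inter> A = B")
    case False
    then have "?t 0 \<le> 0"
      by (auto simp: block_assignment_0)
    with pos have "?t s \<le> 0" if "s < 2 * n" for s
      using that by (cases "s = 0") auto
    then show ?thesis
      by (intro sum_nonpos) auto
  next
    case True
    define G where "G = {s \<in> {1..<2 * n}. gap_support n s \<inter> A = gap_support n 0 \<inter> A}"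
    \<comment> \<open>Facility 0 is overloaded by one client, and the weight is at most 1.\<close>
    have "?t 0 \<le> 1"
      using True by (simp add: block_assignment_0 gap_weight_def)
    moreover have "(\<Sum>s\<in>{1..<2 * n}. ?t s) \<le> (\<Sum>s\<in>G. ?t s)"
      using pos by (subst sum.subset_diff[of G]) (auto simp: G_def intro!: sum_nonpos)
    \<comment> \<open>Points of \<open>G\<close> lie in the same event as point 0; each contributes
      slack \<open>n\<close> with weight \<open>1 / n ^ 2\<close>.\<close>
    moreover have "?t s = - 1 / real n" if "s \<in> G" for s
    proof -
      have s: "0 < s" "s < 2 * n" "gap_support n s \<inter> A = B"
        using that True by (auto simp: G_def)
      then have "?t s = 1 / real n ^ 2 * (real (n ^ 4 - n) - real (n ^ 4))"
        using True unfolding card_load_block[OF n s(1,2)] by (simp add: gap_weight_def)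
      also have "real (n ^ 4 - n) = real (n ^ 4) - real n"
        using n4 by (intro of_nat_diff) simp
      finally show ?thesis
        using n by (simp add: power2_eq_square)
    qed
    then have "(\<Sum>s\<in>G. ?t s) = - real (card G) / real n"
      by simp
    moreover have "- real (card G) / real n \<le> - 1"
      using card_untouched_ge[OF A] n by (simp add: G_def divide_le_eq)
    moreover have "(\<Sum>s<2 * n. ?t s) = ?t 0 + (\<Sum>s\<in>{1..<2 * n}. ?t s)"
      using n by (simp add: lessThan_atLeast0 sum.atLeast_Suc_lessThan)
    ultimately show ?thesis
      by linarith
  qed
qed

lemma gap_mixture_in_sa_relaxation:
  assumes "n \<ge> 2"
  shows "(\<lambda>v. \<Sum>s<2 * n. gap_weight n s * of_bool (v \<in> gap_support n s))
    \<in> sa_relaxation (gap_instance n) (n - 1)"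
  unfolding gap_support_def
proof (rule assignment_mixture_in_sa_relaxation)
  show "sum (gap_weight n) {..<2 * n} = 1"
    using assms by (intro sum_gap_weight) simp
next
  fix i and A B :: "(nat, nat) lp_var set"
  assume "i \<in> facilities (gap_instance n)" "finite A" "card A \<le> n - 1"
  then show "(\<Sum>s<2 * n. gap_weight n s *
      (of_bool (assignment_support (gap_instance n) {0, s} (block_assignment n s) \<inter> A = B) *
       (real (card {j \<in> clients (gap_instance n). block_assignment n s j = i}) -
        real (capacity (gap_instance n)) * of_bool (i \<in> {0, s})))) \<le> 0"
    using gap_mixture_load[OF assms, of i A B] assms unfolding gap_support_def by simp
qed (use assms in \<open>auto simp: gap_weight_nonneg block_assignment_def\<close>)

section \<open>The integrality gap\<close>

lemma lp_cost_gap_mixture: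
  assumes "n \<ge> 1"
  shows "lp_cost (gap_instance n)
    (\<lambda>v. \<Sum>s<2 * n. gap_weight n s * of_bool (v \<in> gap_support n s)) \<le> 2 / real n"
proof -
  have "(\<Sum>s<2 * n. gap_weight n s * of_bool (Y i \<in> gap_support n s)) = 1 / real n ^ 2"
    if "i \<in> {1..<2 * n}" for i
  proof -
    \<comment> \<open>Facility \<open>i > 0\<close> is open only at point \<open>i\<close>.\<close>
    have "(\<Sum>s<2 * n. gap_weight n s * of_bool (Y i \<in> gap_support n s)) =
        (\<Sum>s<2 * n. if s = i then gap_weight n s else 0)"
      using that by (intro sum.cong) (auto simp: gap_support_def assignment_support_simps)
    with that show ?thesis
      by (simp add: gap_weight_def)
  qed
  then have "lp_cost (gap_instance n)
      (\<lambda>v. \<Sum>s<2 * n. gap_weight n s * of_bool (v \<in> gap_support n s)) =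
      real (2 * n - 1) / real n ^ 2"
    unfolding lp_cost_gap_instance by simp
  also have "\<dots> \<le> 2 / real n"
    using assms by (simp add: field_simps power2_eq_square)
  finally show ?thesis .
qed

lemma integrality_gap_gap_instance:
  assumes "n \<ge> 2"
  shows "real n / 2 \<le> integrality_gap (gap_instance n) (sa_relaxation (gap_instance n) (n - 1))"
proof -
  let ?I = "gap_instance n"
  let ?P = "sa_relaxation ?I (n - 1)"
  let ?L = "INF x\<in>?P. lp_cost ?I x"
  define x where "x = (\<lambda>v. \<Sum>s<2 * n. gap_weight n s * of_bool (v \<in> gap_support n s))"
  have x: "x \<in> ?P" "lp_cost ?I x \<le> 2 / real n"
    using gap_mixture_in_sa_relaxation lp_cost_gap_mixture assms by (simp_all add: x_def)
  have ge: "1 / real n ^ 4 \<le> lp_cost ?I x" if "x \<in> ?P" for x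
    using assms that by (intro lp_cost_gap_instance_ge) auto
  have nonempty: "cfl_solutions ?I \<noteq> {}"
    using assms by (intro cfl_solutions_gap_instance) simp
  have "?L \<le> 2 / real n"
    \<comment> \<open>The lower bound \<open>ge\<close> also provides the boundedness that a real
      infimum requires.\<close>
    using ge by (intro cINF_lower2[where f = "lp_cost ?I", OF _ x] bdd_belowI2)
  moreover have "1 / real n ^ 4 \<le> ?L"
    by (rule cINF_greatest[OF _ ge]) (use x(1) in blast)
  moreover have "0 < 1 / real n ^ 4"
    using assms by simp
  moreover have "1 \<le> (INF s\<in>cfl_solutions ?I. cfl_cost ?I s)"
    by (rule cINF_greatest[OF nonempty one_le_cfl_cost_gap_instance])
  ultimately have "1 / (2 / real n) \<le> (INF s\<in>cfl_solutions ?I. cfl_cost ?I s) / ?L"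
    by (intro frac_le) linarith+
  then show ?thesis
    by (simp add: integrality_gap_def)
qed

theorem theorem1:
  shows "\<exists>(I :: nat \<Rightarrow> (nat, nat) cfl) (k :: nat \<Rightarrow> nat).
    (\<forall>n\<ge>1. metric_cfl (I n) \<and> cfl_solutions (I n) \<noteq> {} \<and>
            card (facilities (I n)) = 2 * n \<and> card (clients (I n)) = n ^ 4 + 1) \<and>
    (\<lambda>n. real (k n)) \<in> \<Omega>(\<lambda>n. real n) \<and>
    (\<lambda>n. integrality_gap (I n) (sa_relaxation (I n) (k n))) \<in> \<Omega>(\<lambda>n. real n)"
proof (intro exI conjI)
  show "\<forall>n\<ge>1. metric_cfl (gap_instance n) \<and> cfl_solutions (gap_instance n) \<noteq> {} \<and>
      card (facilities (gap_instance n)) = 2 * n \<and> card (clients (gap_instance n)) = n ^ 4 + 1"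
    by (simp add: metric_cfl_gap_instance cfl_solutions_gap_instance)
  show "(\<lambda>n. real (n - 1)) \<in> \<Omega>(\<lambda>n. real n)"
  proof (rule landau_omega.bigI)
    \<comment> \<open>For \<open>n \<ge> 2\<close>, \<open>n - 1\<close> is at least
      \<open>n / 2\<close>.\<close>
    show "\<forall>\<^sub>F n in at_top. 1 / 2 * norm (real n) \<le> norm (real (n - 1))"
      using eventually_ge_at_top[of 2] by eventually_elim auto
  qed simp
  show "(\<lambda>n. integrality_gap (gap_instance n) (sa_relaxation (gap_instance n) (n - 1)))
    \<in> \<Omega>(\<lambda>n. real n)"
  proof (rule landau_omega.bigI)
    show "\<forall>\<^sub>F n in at_top. 1 / 2 * norm (real n) \<le>
        norm (integrality_gap (gap_instance n) (sa_relaxation (gap_instance n) (n - 1)))"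
      using eventually_ge_at_top[of 2]
      by eventually_elim (use integrality_gap_gap_instance in force)
  qed simp
qed

end
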